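(* Consider $N$-qubit quantum circuits of the following structure: first, an arbitrary local unitary operation $U_1\otimes\cdots\otimes U_N$ (each $U_i$ a single-qubit unitary) is applied; afterwards, an arbitrary (uniform family of) quantum circuit(s) consisting of Toffoli gates and diagonal gates only is applied. Such circuits, when applied to the input state $|0\rangle^{\otimes N}$ and when followed by a computational basis measurement of an arbitrary subset $S$ of the $N$ qubits, can be efficiently simulated classically in the weak sense: it is possible to sample once, in time polynomial in $N$ on a classical computer, from the probability distribution $\{\pi(\alpha)\}$ of the measurement outcomes $\alpha=(\alpha_j : j\in S)$.
   Context: Toffoli is the gate $|a,b,c\rangle\mapsto|a,b,c\oplus ab\rangle$, $a,b,c\in\{0,1\}$. A diagonal gate is a unitary gate that is diagonal in the computational basis. If $\mathcal{V}$ denotes the whole circuit, then $\pi(\alpha)=\sum |\langle y|\mathcal{V}|0\rangle^{\otimes N}|^2$, where the sum is over all $y\in\{0,1\}^N$ with $y_j=\alpha_j$ for all $j\in S$. A uniform family of circuits is one for which a description of the $N$-th circuit (list of gates) can be generated by a classical computer in time polynomial in $N$. The classical computer is a probabilistic one (classical computation supplemented with coin tosses). Weak simulation in general only requires sampling from a distribution sufficiently close to $\{\pi(\alpha)\}$; here the sampling is asserted to be possible exactly, and accuracy issues are omitted. *)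

theory Defs
  imports
    "HOL-Probability.Probability_Mass_Function"
    "HOL-Computational_Algebra.Polynomial"
begin

section \<open>Quantum circuits\<close>

text \<open>
  Computational basis states of \<open>n\<close> qubits are bit strings of length \<open>n\<close>.  An operator is given
  by its matrix in that basis: \<open>A x y\<close> is the entry in row \<open>x\<close> and column \<open>y\<close>, and only the
  entries with \<open>x, y \<in> bits n\<close> matter.
\<close>

definition bits :: "nat \<Rightarrow> bool list set" where
  "bits n = {x. length x = n}"

type_synonym qop = "bool list \<Rightarrow> bool list \<Rightarrow> complex"

definition unitary :: "nat \<Rightarrow> qop \<Rightarrow> bool" where
  "unitary n A \<longleftrightarrow>
     (\<forall>x\<in>bits n. \<forall>y\<in>bits n.
        (\<Sum>z\<in>bits n. cnj (A z x) * A z y) = (if x = y then 1 else 0) \<and>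
        (\<Sum>z\<in>bits n. A x z * cnj (A y z)) = (if x = y then 1 else 0))"

definition diagonal :: "nat \<Rightarrow> qop \<Rightarrow> bool" where
  "diagonal n A \<longleftrightarrow> (\<forall>x\<in>bits n. \<forall>y\<in>bits n. x \<noteq> y \<longrightarrow> A x y = 0)"

definition qop_mult :: "nat \<Rightarrow> qop \<Rightarrow> qop \<Rightarrow> qop" where
  "qop_mult n A B = (\<lambda>x y. \<Sum>z\<in>bits n. A x z * B z y)"

text \<open>\<open>U\<^sub>0 \<otimes> \<dots> \<otimes> U\<^sub>N\<^sub>-\<^sub>1\<close>; qubits are numbered from \<open>0\<close>.\<close>

definition local_op :: "nat \<Rightarrow> (nat \<Rightarrow> qop) \<Rightarrow> qop" where
  "local_op N U = (\<lambda>x y. \<Prod>i<N. U i [x ! i] [y ! i])"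

text \<open>\<open>G\<close> applied to the qubits \<open>qs\<close> (in this order), tensored with the identity on the others.\<close>

definition embed_op :: "nat \<Rightarrow> nat list \<Rightarrow> qop \<Rightarrow> qop" where
  "embed_op N qs G = (\<lambda>x y.
     if \<forall>i<N. i \<notin> set qs \<longrightarrow> x ! i = y ! i
     then G (map (\<lambda>i. x ! i) qs) (map (\<lambda>i. y ! i) qs) else 0)"

definition toffoli :: qop where
  "toffoli = (\<lambda>x y. if x = [y ! 0, y ! 1, y ! 2 \<noteq> (y ! 0 \<and> y ! 1)] then 1 else 0)"

text \<open>
  \<open>Diagonal l qs\<close> is the diagonal gate with label \<open>l\<close>, acting on an arbitrary number of qubits
  \<open>qs\<close>.  As diagonal gates form a continuum, a finite description can only name them: which
  operator a label stands for is given by an arbitrary library \<open>lib :: bool list \<Rightarrow> qop\<close>.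
\<close>

datatype gate = Toffoli nat nat nat | Diagonal "bool list" "nat list"

fun gate_op :: "(bool list \<Rightarrow> qop) \<Rightarrow> nat \<Rightarrow> gate \<Rightarrow> qop" where
  "gate_op lib N (Toffoli a b c) = embed_op N [a, b, c] toffoli"
| "gate_op lib N (Diagonal l qs) = embed_op N qs (lib l)"

fun wf_gate :: "(bool list \<Rightarrow> qop) \<Rightarrow> nat \<Rightarrow> gate \<Rightarrow> bool" where
  "wf_gate lib N (Toffoli a b c) \<longleftrightarrow> distinct [a, b, c] \<and> {a, b, c} \<subseteq> {..<N}"
| "wf_gate lib N (Diagonal l qs) \<longleftrightarrow> distinct qs \<and> set qs \<subseteq> {..<N} \<and>
     unitary (length qs) (lib l) \<and> diagonal (length qs) (lib l)"

text \<open>The local operation comes first, then the gates in list order.\<close>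

definition circuit_op :: "(bool list \<Rightarrow> qop) \<Rightarrow> nat \<Rightarrow> (nat \<Rightarrow> qop) \<Rightarrow> gate list \<Rightarrow> qop" where
  "circuit_op lib N U gs = fold (\<lambda>g A. qop_mult N (gate_op lib N g) A) gs (local_op N U)"

text \<open>
  An outcome \<open>\<alpha> = (\<alpha>\<^sub>j : j \<in> S)\<close> is the list of the measured bits by increasing \<open>j\<close>; \<open>nths y S\<close>
  is the restriction of \<open>y\<close> to \<open>S\<close> in that form.
\<close>

definition outcome_prob :: "nat \<Rightarrow> qop \<Rightarrow> nat set \<Rightarrow> bool list \<Rightarrow> real" where
  "outcome_prob N V S \<alpha> =
     (\<Sum>y\<in>{y \<in> bits N. nths y S = \<alpha>}. (cmod (V y (replicate N False)))\<^sup>2)"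


section \<open>Probabilistic classical computation\<close>

text \<open>
  Structured programs over finitely many stacks of bits.  Every step inspects or changes only the
  top of a stack, so (reading stacks as tapes) programs and multi-tape Turing machines simulate
  each other with constant-factor overhead.

  Real-valued inputs are held on a separate one-way read-only tape.  They have a single use: a
  coin may be tossed whose bias is a polynomial, fixed in the program text and with rational
  coefficients, in the next few numbers on the tape (so the coin toss is exact).  Results of real
  arithmetic cannot be stored, hence no long exact real computations are available.  On an empty
  real tape a program is an ordinary probabilistic machine whose coins have rational biases.
\<close>

datatype bias = Rational rat | Cell nat | Plus bias bias | Times bias bias

primrec bias_val :: "real list \<Rightarrow> bias \<Rightarrow> real" where
  "bias_val rs (Rational q) = of_rat q"
| "bias_val rs (Cell k) = (if k < length rs then rs ! k else 0)"
| "bias_val rs (Plus e f) = bias_val rs e + bias_val rs f"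
| "bias_val rs (Times e f) = bias_val rs e * bias_val rs f"

datatype test = Nonempty nat | Top nat

datatype prog =
    Skip
  | Push nat bool
  | Pop nat
  | Coin nat bias
  | Advance
  | Seq prog prog
  | Cond test prog prog
  | While test prog

type_synonym state = "(nat \<Rightarrow> bool list) \<times> real list"

primrec test_val :: "state \<Rightarrow> test \<Rightarrow> bool" where
  "test_val s (Nonempty r) \<longleftrightarrow> fst s r \<noteq> []"
| "test_val s (Top r) \<longleftrightarrow> fst s r \<noteq> [] \<and> hd (fst s r)"

definition push :: "nat \<Rightarrow> bool \<Rightarrow> state \<Rightarrow> state" where
  "push r b s = ((fst s)(r := b # fst s r), snd s)"

text \<open>
  One computation step; \<open>Skip\<close> means that the computation has halted.  \<open>Coin r e\<close> pushes a random
  bit that is \<open>True\<close> with probability \<open>e\<close> (\<open>bernoulli_pmf\<close> truncates to the unit interval).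
\<close>

primrec step :: "prog \<Rightarrow> state \<Rightarrow> (prog \<times> state) pmf" where
  "step Skip s = return_pmf (Skip, s)"
| "step (Push r b) s = return_pmf (Skip, push r b s)"
| "step (Pop r) s = return_pmf (Skip, ((fst s)(r := tl (fst s r)), snd s))"
| "step (Coin r e) s = map_pmf (\<lambda>b. (Skip, push r b s)) (bernoulli_pmf (bias_val (snd s) e))"
| "step Advance s = return_pmf (Skip, (fst s, tl (snd s)))"
| "step (Seq c d) s =
     (if c = Skip then return_pmf (d, s) else map_pmf (\<lambda>(c', s'). (Seq c' d, s')) (step c s))"
| "step (Cond t c d) s = return_pmf (if test_val s t then c else d, s)"
| "step (While t c) s = return_pmf (if test_val s t then Seq c (While t c) else Skip, s)"

primrec run :: "nat \<Rightarrow> prog \<times> state \<Rightarrow> (prog \<times> state) pmf" where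
  "run 0 cs = return_pmf cs"
| "run (Suc t) cs = bind_pmf (step (fst cs) (snd cs)) (run t)"

text \<open>Input string \<open>i\<close> is initially on stack \<open>i\<close>; all further stacks are empty.\<close>

definition init :: "bool list list \<Rightarrow> real list \<Rightarrow> state" where
  "init inp rs = (\<lambda>r. if r < length inp then inp ! r else [], rs)"

text \<open>
  On every computation path the program halts within \<open>t\<close> steps, and the content of stack \<open>0\<close> is
  then distributed according to \<open>D\<close>.
\<close>

definition samples_within :: "prog \<Rightarrow> bool list list \<Rightarrow> real list \<Rightarrow> nat \<Rightarrow> bool list pmf \<Rightarrow> bool"
where
  "samples_within c inp rs t D \<longleftrightarrow>
     (\<forall>x\<in>set_pmf (run t (c, init inp rs)). fst x = Skip) \<and>
     map_pmf (\<lambda>x. fst (snd x) 0) (run t (c, init inp rs)) = D"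


section \<open>Uniform families and inputs\<close>

text \<open>A self-delimiting binary description of gate lists; qubit indices are written in unary.\<close>

definition enc_nat :: "nat \<Rightarrow> bool list" where
  "enc_nat n = replicate n True @ [False]"

definition enc_list :: "('a \<Rightarrow> bool list) \<Rightarrow> 'a list \<Rightarrow> bool list" where
  "enc_list enc xs = concat (map (\<lambda>x. True # enc x) xs) @ [False]"

fun enc_gate :: "gate \<Rightarrow> bool list" where
  "enc_gate (Toffoli a b c) = True # enc_nat a @ enc_nat b @ enc_nat c"
| "enc_gate (Diagonal l qs) = False # enc_list (\<lambda>b. [b]) l @ enc_list enc_nat qs"

definition enc_circuit :: "gate list \<Rightarrow> bool list" where
  "enc_circuit = enc_list enc_gate"

definition uniform_family :: "(nat \<Rightarrow> gate list) \<Rightarrow> bool" where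
  "uniform_family C \<longleftrightarrow>
     (\<exists>c (p :: nat poly). \<forall>N.
        samples_within c [replicate N True] [] (poly p N) (return_pmf (enc_circuit (C N))))"

text \<open>The real and imaginary parts of all entries of \<open>U\<^sub>0, \<dots>, U\<^sub>N\<^sub>-\<^sub>1\<close>, row by row.\<close>

definition local_data :: "nat \<Rightarrow> (nat \<Rightarrow> qop) \<Rightarrow> real list" where
  "local_data N U = concat (map (\<lambda>i. concat (map (\<lambda>(a, b). [Re (U i [a] [b]), Im (U i [a] [b])])
     [(False, False), (False, True), (True, False), (True, True)])) [0..<N])"

definition subset_data :: "nat \<Rightarrow> nat set \<Rightarrow> bool list" where
  "subset_data N S = map (\<lambda>j. j \<in> S) [0..<N]"

end

theory Submission
  imports Defs
begin

text \<open>
  Toffoli and diagonal gates only permute the computational basis, up to phases.  Hence the final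
  state is measured in \<open>F x\<close> with the probability of \<open>x\<close> after the local operation, where \<open>F\<close> is
  the classical circuit of the Toffoli gates, and that probability is a product over the qubits.
  So the simulator tosses one coin per qubit, with bias \<open>|\<langle>1|U\<^sub>i|0\<rangle>|\<^sup>2\<close>, applies the Toffoli gates of the
  generated circuit to the resulting bits, skipping the diagonal ones, and outputs the bits in \<open>S\<close>.

  All real inputs are consumed by the coin tosses.  Therefore the generator of the circuit runs
  unchanged on the empty real tape it expects, with all intermediate data on stacks that it does
  not use.
\<close>

section \<open>Program logic\<close>

text \<open>Equality with a distribution on halted configurations forces every path to halt; since
  \<open>Skip\<close> steps to itself, \<open>t\<close> acts as an upper bound on the running
  time.\<close>

definition reaches :: "prog \<Rightarrow> state \<Rightarrow> nat \<Rightarrow> state pmf \<Rightarrow> bool" where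
  "reaches c s t D \<longleftrightarrow> run t (c, s) = map_pmf (Pair Skip) D"

abbreviation reaches_state :: "prog \<Rightarrow> state \<Rightarrow> nat \<Rightarrow> state \<Rightarrow> bool" where
  "reaches_state c s t s' \<equiv> reaches c s t (return_pmf s')"

lemma run_Skip: "run t (Skip, s) = return_pmf (Skip, s)"
  by (induction t) (simp_all add: bind_return_pmf)

lemma run_add: "run (t + k) x = bind_pmf (run t x) (run k)"
proof (induction t arbitrary: x)
  case (Suc t)
  have "run (t + k) = (\<lambda>y. bind_pmf (run t y) (run k))"
    using Suc by auto
  then show ?case by (simp add: bind_assoc_pmf)
qed (simp add: bind_return_pmf)

lemma reaches_mono:
  assumes "reaches c s t D" "t \<le> t'"
  shows "reaches c s t' D"
proof -
  obtain k where "t' = t + k" using assms(2) le_Suc_ex by blast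
  then show ?thesis
    using assms(1)
    by (simp add: reaches_def run_add run_Skip map_pmf_def bind_assoc_pmf bind_return_pmf)
qed

lemma reaches_eqI:
  assumes "reaches c s t D" "D = D'" "t \<le> t'"
  shows "reaches c s t' D'"
  using assms by (auto intro: reaches_mono)

lemma run_halted:
  assumes "\<forall>x\<in>set_pmf (run t (c, s)). fst x = Skip"
  shows "reaches c s t (map_pmf snd (run t (c, s)))"
  unfolding reaches_def map_pmf_comp
  using assms by (intro map_pmf_idI[symmetric]) (metis prod.collapse)

lemma map_Pair_eq_return:
  assumes "map_pmf (Pair a) D = return_pmf (c, s)"
  shows "c = a \<and> D = return_pmf s"
proof -
  have "map_pmf fst (map_pmf (Pair a) D) = return_pmf c" "map_pmf snd (map_pmf (Pair a) D) = return_pmf s"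
    by (simp_all add: assms)
  then show ?thesis by (simp add: map_pmf_comp)
qed

lemma reaches_Seq_Skip:
  assumes "reaches d s t D"
  shows "reaches (Seq Skip d) s (Suc t) D"
  using assms by (simp add: reaches_def bind_return_pmf)

text \<open>Paths on which \<open>c\<close> halts early idle in \<open>Skip\<close>, so one bound
  \<open>t'\<close> valid on the whole support of \<open>D\<close> suffices; the extra step hands
  control to \<open>d\<close>.\<close>

lemma reaches_Seq:
  assumes "reaches c s t D" "\<And>s'. s' \<in> set_pmf D \<Longrightarrow> reaches d s' t' (E s')"
  shows "reaches (Seq c d) s (t + t' + 1) (bind_pmf D E)"
  using assms
proof (induction t arbitrary: c s D)
  case 0
  have "c = Skip \<and> D = return_pmf s"
    using 0 by (intro map_Pair_eq_return) (simp add: reaches_def)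
  then show ?case
    using 0 by (auto simp: bind_return_pmf intro!: reaches_Seq_Skip)
next
  case (Suc t)
  show ?case
  proof (cases "c = Skip")
    case True
    then have "map_pmf (Pair Skip) D = return_pmf (Skip, s)"
      using Suc.prems(1) by (simp only: reaches_def run_Skip)
    then have D: "D = return_pmf s"
      by (rule map_Pair_eq_return[THEN conjunct2])
    have "reaches (Seq Skip d) s (Suc t') (E s)"
      using Suc.prems(2) D by (intro reaches_Seq_Skip) simp
    then show ?thesis
      using True D by (auto simp: bind_return_pmf elim: reaches_mono)
  next
    case False
    \<comment> \<open>\<open>D\<close> is the mixture of the distributions \<open>?D\<close> over
      the first step of \<open>c\<close>; every successor still halts on all paths, so the induction
      hypothesis applies to each.\<close>
    let ?D = "\<lambda>x. map_pmf snd (run t x)"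
    have run: "bind_pmf (step c s) (run t) = map_pmf (Pair Skip) D"
      using Suc.prems(1) by (simp add: reaches_def)
    have "D = map_pmf snd (map_pmf (Pair Skip) D)"
      by (simp add: map_pmf_comp)
    then have D: "D = bind_pmf (step c s) ?D"
      by (simp only: run[symmetric] map_bind_pmf)
    have "run (t + t' + 1) (Seq c' d, s') = map_pmf (Pair Skip) (bind_pmf (?D (c', s')) E)"
      if x: "(c', s') \<in> set_pmf (step c s)" for c' s'
    proof -
      have "\<forall>y\<in>set_pmf (run t (c', s')). fst y = Skip"
        using x arg_cong[OF run, of set_pmf] by fastforce
      then have "reaches c' s' t (?D (c', s'))" by (rule run_halted)
      moreover have "reaches d s'' t' (E s'')" if "s'' \<in> set_pmf (?D (c', s'))" for s''
        using Suc.prems(2) x that by (force simp: D)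
      ultimately show ?thesis
        using Suc.IH by (simp only: reaches_def)
    qed
    then have "bind_pmf (step c s) (\<lambda>(c', s'). run (t + t' + 1) (Seq c' d, s'))
        = bind_pmf (step c s) (\<lambda>x. map_pmf (Pair Skip) (bind_pmf (?D x) E))"
      by (intro bind_pmf_cong) auto
    then show ?thesis
      using False
      by (simp add: reaches_def D bind_map_pmf bind_assoc_pmf map_bind_pmf case_prod_unfold)
  qed
qed

lemma reaches_Seq_state:
  assumes "reaches_state c s t s'" "reaches d s' t' D"
  shows "reaches (Seq c d) s (t + t' + 1) D"
  using reaches_Seq[OF assms(1), of d t' "\<lambda>_. D"] assms(2) by (simp add: bind_return_pmf)

lemma reaches_While_stop:
  assumes "\<not> test_val s b"
  shows "reaches_state (While b c) s 1 s"
  using assms by (simp add: reaches_def bind_return_pmf)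

lemma reaches_While_stopI:
  assumes "\<not> test_val s b" "s = s'" "1 \<le> t"
  shows "reaches_state (While b c) s t s'"
  using reaches_mono[OF reaches_While_stop[OF assms(1)] assms(3)] assms(2) by simp

text \<open>The two extra steps are the unfolding of the loop and the passage from the finished body
  back to the loop.\<close>

lemma reaches_While_step:
  assumes "test_val s b" "reaches c s t D"
    and "\<And>s'. s' \<in> set_pmf D \<Longrightarrow> reaches (While b c) s' t' (E s')"
  shows "reaches (While b c) s (t + t' + 2) (bind_pmf D E)"
  using reaches_Seq[OF assms(2,3)] assms(1) by (simp add: reaches_def bind_return_pmf)

lemma reaches_While_step_state:
  assumes "test_val s b" "reaches_state c s t s'" "reaches (While b c) s' t' D"
  shows "reaches (While b c) s (t + t' + 2) D"
  using reaches_While_step[OF assms(1,2), of t' "\<lambda>_. D"] assms(3) by (simp add: bind_return_pmf)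

lemma reaches_Cond:
  assumes "reaches (if test_val s b then c else d) s t D"
  shows "reaches (Cond b c d) s (Suc t) D"
  using assms by (simp add: reaches_def bind_return_pmf)

lemma reaches_Coin:
  "reaches (Coin r e) s 1 (map_pmf (\<lambda>b. push r b s) (bernoulli_pmf (bias_val (snd s) e)))"
proof -
  have "run 0 = return_pmf" by auto
  then show ?thesis by (simp add: reaches_def map_pmf_comp bind_return_pmf')
qed

subsection \<open>Straight-line code\<close>

text \<open>Without coins and loops the final state is a function of the initial one, so loop bodies
  can be verified by simplifying \<open>effect\<close> instead of following
  \<open>run\<close>.\<close>

primrec straight_line :: "prog \<Rightarrow> bool" where
  "straight_line Skip \<longleftrightarrow> True"
| "straight_line (Push r b) \<longleftrightarrow> True"
| "straight_line (Pop r) \<longleftrightarrow> True"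
| "straight_line (Coin r e) \<longleftrightarrow> False"
| "straight_line Advance \<longleftrightarrow> True"
| "straight_line (Seq c d) \<longleftrightarrow> straight_line c \<and> straight_line d"
| "straight_line (Cond b c d) \<longleftrightarrow> straight_line c \<and> straight_line d"
| "straight_line (While b c) \<longleftrightarrow> False"

text \<open>The values for \<open>Coin\<close> and \<open>While\<close> are placeholders for
  programs that \<open>straight_line\<close> excludes.\<close>

primrec effect :: "prog \<Rightarrow> state \<Rightarrow> state" where
  "effect Skip s = s"
| "effect (Push r b) s = push r b s"
| "effect (Pop r) s = ((fst s)(r := tl (fst s r)), snd s)"
| "effect (Coin r e) s = s"
| "effect Advance s = (fst s, tl (snd s))"
| "effect (Seq c d) s = effect d (effect c s)"
| "effect (Cond b c d) s = (if test_val s b then effect c s else effect d s)"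
| "effect (While b c) s = s"

primrec cost :: "prog \<Rightarrow> nat" where
  "cost Skip = 0"
| "cost (Push r b) = 1"
| "cost (Pop r) = 1"
| "cost (Coin r e) = 1"
| "cost Advance = 1"
| "cost (Seq c d) = cost c + cost d + 1"
| "cost (Cond b c d) = Suc (max (cost c) (cost d))"
| "cost (While b c) = 0"

lemma reaches_effect:
  assumes "straight_line c"
  shows "reaches_state c s (cost c) (effect c s)"
  using assms
proof (induction c arbitrary: s)
  case (Seq c d)
  then show ?case
    using reaches_Seq_state[of c s "cost c" "effect c s" d "cost d"] by simp
next
  case (Cond b c d)
  have "reaches_state (if test_val s b then c else d) s (max (cost c) (cost d))
      (effect (Cond b c d) s)"
  proof (cases "test_val s b")
    case True
    then show ?thesis
      using reaches_mono[of c s "cost c" _ "max (cost c) (cost d)"] Cond.IH(1)[of s] Cond.prems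
      by simp
  next
    case False
    then show ?thesis
      using reaches_mono[of d s "cost d" _ "max (cost c) (cost d)"] Cond.IH(2)[of s] Cond.prems
      by simp
  qed
  from reaches_Cond[OF this] show ?case by simp
qed (simp_all add: reaches_def bind_return_pmf)

lemma reaches_effectI:
  assumes "straight_line c" "effect c s = s'" "cost c \<le> t"
  shows "reaches_state c s t s'"
  using reaches_mono[OF reaches_effect[OF assms(1), of s] assms(3)] assms(2) by simp

primrec block :: "prog list \<Rightarrow> prog" where
  "block [] = Skip"
| "block (c # cs) = Seq c (block cs)"

subsection \<open>Framing\<close>

text \<open>Stacks below \<open>M\<close> belong to the running program, those from \<open>M\<close>
  on to its caller. The real tape is shared, so it must be as the running program expects
  it.\<close>

definition frame :: "nat \<Rightarrow> (nat \<Rightarrow> bool list) \<Rightarrow> state \<Rightarrow> state" where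
  "frame M g s = ((\<lambda>r. if r < M then fst s r else g r), snd s)"

primrec test_stacks :: "test \<Rightarrow> nat set" where
  "test_stacks (Nonempty r) = {r}"
| "test_stacks (Top r) = {r}"

primrec stacks :: "prog \<Rightarrow> nat set" where
  "stacks Skip = {}"
| "stacks (Push r b) = {r}"
| "stacks (Pop r) = {r}"
| "stacks (Coin r e) = {r}"
| "stacks Advance = {}"
| "stacks (Seq c d) = stacks c \<union> stacks d"
| "stacks (Cond b c d) = test_stacks b \<union> stacks c \<union> stacks d"
| "stacks (While b c) = test_stacks b \<union> stacks c"

lemma finite_stacks: "finite (stacks c)"
proof -
  have "finite (test_stacks b)" for b by (cases b) auto
  then show ?thesis by (induction c) auto
qed

lemma push_frame: "r < M \<Longrightarrow> push r b (frame M g s) = frame M g (push r b s)"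
  by (auto simp: push_def frame_def)

lemma test_val_frame: "test_stacks b \<subseteq> {..<M} \<Longrightarrow> test_val (frame M g s) b = test_val s b"
  by (cases b) (auto simp: frame_def)

lemma step_frame:
  assumes "stacks c \<subseteq> {..<M}"
  shows "step c (frame M g s) = map_pmf (apsnd (frame M g)) (step c s)"
  using assms
proof (induction c arbitrary: s)
  case (Pop r)
  then show ?case by (auto simp: frame_def fun_eq_iff)
next
  case Advance
  then show ?case by (auto simp: frame_def)
next
  case (Coin r e)
  then show ?case by (simp add: map_pmf_comp push_frame) (simp add: frame_def)
next
  case (Seq c d)
  then show ?case by (auto simp: map_pmf_comp case_prod_unfold)
qed (auto simp: push_frame test_val_frame)

text \<open>A successor is assembled from pieces of the current program, even when a loop unfolds;
  this carries the side condition of \<open>run_frame\<close> through its induction.\<close>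

lemma step_stacks:
  assumes "(c', s') \<in> set_pmf (step c s)"
  shows "stacks c' \<subseteq> stacks c"
  using assms by (induction c arbitrary: s c' s') (auto split: if_splits, (blast | fastforce)+)

lemma run_frame:
  assumes "stacks c \<subseteq> {..<M}"
  shows "run t (c, frame M g s) = map_pmf (apsnd (frame M g)) (run t (c, s))"
  using assms
proof (induction t arbitrary: c s)
  case (Suc t)
  have "run t (c', frame M g s') = map_pmf (apsnd (frame M g)) (run t (c', s'))"
    if "(c', s') \<in> set_pmf (step c s)" for c' s'
    using Suc.IH step_stacks[OF that] Suc.prems by blast
  then show ?case
    using Suc.prems
    by (auto simp: step_frame bind_map_pmf map_bind_pmf intro!: bind_pmf_cong)
qed simp

text \<open>A step pushes at most one bit. This bounds the size of the generated circuit description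
  by the input length plus the generator's running time.\<close>

lemma run_length:
  assumes "(c', s') \<in> set_pmf (run t (c, s))"
  shows "length (fst s' r) \<le> length (fst s r) + t"
proof -
  have step: "length (fst s' r) \<le> Suc (length (fst s r))" if "(c', s') \<in> set_pmf (step c s)" for c' s' c s
    using that
    by (induction c arbitrary: s c' s') (auto simp: push_def split: if_splits)
  show ?thesis
    using assms
  proof (induction t arbitrary: c s)
    case (Suc t)
    then obtain c1 s1 where "(c1, s1) \<in> set_pmf (step c s)" "(c', s') \<in> set_pmf (run t (c1, s1))"
      by auto
    with Suc.IH step show ?case by fastforce
  qed simp
qed


section \<open>The simulator\<close>

definition move :: "nat \<Rightarrow> nat \<Rightarrow> prog" where
  "move i j = Cond (Top i) (Seq (Pop i) (Push j True)) (Seq (Pop i) (Push j False))"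

lemma straight_line_move [simp]: "straight_line (move i j)"
  by (simp add: move_def)

lemma cost_move [simp]: "cost (move i j) = 4"
  by (simp add: move_def)

lemma effect_move [simp]:
  "i \<noteq> j \<Longrightarrow> f i = b # xs \<Longrightarrow> effect (move i j) (f, rs) = (f(i := xs, j := b # f j), rs)"
  by (auto simp: move_def push_def)

subsection \<open>Sampling the initial bits\<close>

text \<open>The product of Bernoulli distributions: what a basis measurement of a product state
  yields.\<close>

primrec bernoulli_list :: "real list \<Rightarrow> bool list pmf" where
  "bernoulli_list [] = return_pmf []"
| "bernoulli_list (p # ps) =
     bind_pmf (bernoulli_pmf p) (\<lambda>b. map_pmf (Cons b) (bernoulli_list ps))"

text \<open>In the mixture over the first coin only the term with the right head bit survives, as
  \<open>Cons a\<close> is injective and produces head \<open>a\<close>. The bounds on the biases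
  ensure that \<open>bernoulli_pmf\<close> does not truncate.\<close>

lemma pmf_bernoulli_list:
  assumes "\<forall>p\<in>set ps. 0 \<le> p \<and> p \<le> 1" "length x = length ps"
  shows "pmf (bernoulli_list ps) x = (\<Prod>i<length ps. if x ! i then ps ! i else 1 - ps ! i)"
  using assms
proof (induction ps arbitrary: x)
  case (Cons p ps)
  then obtain b x' where x: "x = b # x'" "length x' = length ps"
    by (auto simp: length_Suc_conv)
  have cons: "pmf (map_pmf (Cons a) (bernoulli_list ps)) (b # x')
      = (if a = b then pmf (bernoulli_list ps) x' else 0)" for a
  proof (cases "a = b")
    case True
    then show ?thesis using pmf_map_inj'[of "Cons b" "bernoulli_list ps" x'] by simp
  next
    case False
    then show ?thesis by (auto simp: pmf_eq_0_set_pmf)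
  qed
  have "pmf (bernoulli_list (p # ps)) x = (if b then p else 1 - p) * pmf (bernoulli_list ps) x'"
    using Cons.prems x by (auto simp: pmf_bind cons)
  moreover have "pmf (bernoulli_list ps) x' = (\<Prod>i<length ps. if x' ! i then ps ! i else 1 - ps ! i)"
    using Cons.prems(1) x(2) by (intro Cons.IH) auto
  moreover have "(\<Prod>i<length (p # ps). if x ! i then (p # ps) ! i else 1 - (p # ps) ! i)
      = (if b then p else 1 - p) * (\<Prod>i<length ps. if x' ! i then ps ! i else 1 - ps ! i)"
    unfolding x list.size One_nat_def add_Suc_right add_0_right prod.lessThan_Suc_shift
    by (simp only: nth_Cons_0 nth_Cons_Suc)
  ultimately show ?case
    by (simp only: x)
qed simp

lemma length_bernoulli_list: "x \<in> set_pmf (bernoulli_list ps) \<Longrightarrow> length x = length ps"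
  by (induction ps arbitrary: x) auto

text \<open>The unary input serves as loop counter and is saved on \<open>V\<close>, to be given
  back to the generator. Moving the membership bits to \<open>W\<close> empties stack 1, as the
  generator expects.\<close>

definition sample_bit :: "nat \<Rightarrow> nat \<Rightarrow> nat \<Rightarrow> prog" where
  "sample_bit T V W = Seq (block [Pop 0, Push V True, move 1 W])
     (Seq (Coin T (Plus (Times (Cell 4) (Cell 4)) (Times (Cell 5) (Cell 5))))
       (block (replicate 8 Advance)))"

text \<open>Cells 4 and 5 of the eight numbers describing \<open>U i\<close> hold the real and imaginary part of
  \<open>U i [True] [False]\<close>.\<close>

abbreviation sq_norm45 :: "real list \<Rightarrow> real" where
  "sq_norm45 d \<equiv> d ! 4 * d ! 4 + d ! 5 * d ! 5"

lemma reaches_sample_bit: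
  assumes "distinct [0, 1, T, V, W]" "length d = 8" "f 0 = a # n" "f 1 = b # ss"
  shows "reaches (sample_bit T V W) (f, d @ ds) 29
    (map_pmf (\<lambda>x. (f(0 := n, 1 := ss, V := True # f V, W := b # f W, T := x # f T), ds))
      (bernoulli_pmf (sq_norm45 d)))"
proof -
  let ?f = "f(0 := n, 1 := ss, V := True # f V, W := b # f W)"
  have 1: "reaches_state (block [Pop 0, Push V True, move 1 W]) (f, d @ ds) 9 (?f, d @ ds)"
    by (rule reaches_effectI) (use assms in \<open>auto simp: push_def fun_eq_iff\<close>)
  have 2: "reaches_state (block (replicate 8 Advance)) (g, d @ ds) 16 (g, ds)" for g
    by (rule reaches_effectI) (use assms in \<open>auto simp: numeral_eq_Suc length_Suc_conv\<close>)
  have bias: "bias_val (d @ ds) (Plus (Times (Cell 4) (Cell 4)) (Times (Cell 5) (Cell 5))) = sq_norm45 d"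
    using assms by (simp add: nth_append)
  have 3: "reaches (Coin T (Plus (Times (Cell 4) (Cell 4)) (Times (Cell 5) (Cell 5)))) (?f, d @ ds) 1
      (map_pmf (\<lambda>x. (?f(T := x # f T), d @ ds)) (bernoulli_pmf (sq_norm45 d)))"
    using reaches_Coin[of T "Plus (Times (Cell 4) (Cell 4)) (Times (Cell 5) (Cell 5))" "(?f, d @ ds)"]
      assms by (simp add: bias push_def del: bias_val.simps)
  have "reaches (sample_bit T V W) (f, d @ ds) (9 + (1 + 16 + 1) + 1)
      (bind_pmf (map_pmf (\<lambda>x. (?f(T := x # f T), d @ ds)) (bernoulli_pmf (sq_norm45 d)))
        (\<lambda>s. return_pmf (fst s, ds)))"
    unfolding sample_bit_def
    by (intro reaches_Seq_state[OF 1] reaches_Seq[OF 3]) (use 2 in auto)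
  then show ?thesis
    unfolding bind_map_pmf map_pmf_def[symmetric] map_pmf_comp fst_conv
    by (rule reaches_mono) simp
qed

lemma reaches_sample_bits:
  assumes "distinct [0, 1, T, V, W]" "\<forall>d\<in>set ds. length d = 8"
    and "f 0 = replicate (length ds) True" "f 1 = ss" "length ss = length ds"
  shows "reaches (While (Nonempty 0) (sample_bit T V W)) (f, concat ds) (31 * length ds + 1)
    (map_pmf (\<lambda>x. (f(0 := [], 1 := [], V := replicate (length ds) True @ f V, W := rev ss @ f W,
        T := rev x @ f T), [])) (bernoulli_list (map sq_norm45 ds)))"
  using assms(2-)
proof (induction ds arbitrary: f ss)
  case Nil
  have "reaches_state (While (Nonempty 0) (sample_bit T V W)) (f, []) 1 (f, [])"
    using Nil by (intro reaches_While_stop) simp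
  then show ?case
    unfolding list.map concat.simps
    by (rule reaches_eqI) (use Nil in \<open>auto simp: fun_eq_iff\<close>)
next
  case (Cons d ds)
  obtain b ss' where ss: "ss = b # ss'" "length ss' = length ds"
    using Cons.prems by (auto simp: length_Suc_conv)
  let ?n = "replicate (length ds) True"
  let ?f = "\<lambda>x. f(0 := ?n, 1 := ss', V := True # f V, W := b # f W, T := x # f T)"
  \<comment> \<open>The claim for the remaining qubits as a function of the state after the first
    coin, which is the form that \<open>reaches_While_step\<close> needs.\<close>
  let ?E = "\<lambda>s. map_pmf (\<lambda>x. ((fst s)(0 := [], 1 := [], V := ?n @ fst s V, W := rev ss' @ fst s W,
        T := rev x @ fst s T), [])) (bernoulli_list (map sq_norm45 ds))"
  have 1: "reaches (sample_bit T V W) (f, d @ concat ds) 29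
      (map_pmf (\<lambda>x. (?f x, concat ds)) (bernoulli_pmf (sq_norm45 d)))"
    using Cons.prems ss assms(1) by (intro reaches_sample_bit) auto
  have "reaches (While (Nonempty 0) (sample_bit T V W)) (f, d @ concat ds)
      (29 + (31 * length ds + 1) + 2)
      (bind_pmf (map_pmf (\<lambda>x. (?f x, concat ds)) (bernoulli_pmf (sq_norm45 d))) ?E)"
  proof (rule reaches_While_step[OF _ 1])
    show "test_val (f, d @ concat ds) (Nonempty 0)" using Cons.prems by simp
    fix s assume "s \<in> set_pmf (map_pmf (\<lambda>x. (?f x, concat ds)) (bernoulli_pmf (sq_norm45 d)))"
    then obtain x where s: "s = (?f x, concat ds)" by auto
    show "reaches (While (Nonempty 0) (sample_bit T V W)) s (31 * length ds + 1) (?E s)"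
      unfolding s fst_conv using Cons.prems ss assms(1) by (intro Cons.IH) auto
  qed
  moreover have "bind_pmf (map_pmf (\<lambda>x. (?f x, concat ds)) (bernoulli_pmf (sq_norm45 d))) ?E =
      map_pmf (\<lambda>x. (f(0 := [], 1 := [], V := replicate (length (d # ds)) True @ f V,
        W := rev ss @ f W, T := rev x @ f T), [])) (bernoulli_list (map sq_norm45 (d # ds)))"
    unfolding bernoulli_list.simps list.map bind_map_pmf map_bind_pmf map_pmf_comp
    using assms(1) ss
    by (intro bind_pmf_cong map_pmf_cong refl prod.inject[THEN iffD2] conjI ext)
      (simp add: replicate_app_Cons_same)
  ultimately show ?case
    unfolding concat.simps by (rule reaches_eqI) simp
qed

text \<open>The marks on \<open>V\<close> are as many as the sampled bits on \<open>T\<close>, so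
  counting down \<open>V\<close> also empties \<open>T\<close>.\<close>

definition restore_input :: "nat \<Rightarrow> nat \<Rightarrow> nat \<Rightarrow> prog" where
  "restore_input B T V = While (Nonempty V) (block [Pop V, Push 0 True, move T B])"

lemma reaches_restore_input:
  assumes "distinct [0, B, T, V]" "f V = replicate (length x) True" "f T = x"
  shows "reaches_state (restore_input B T V) (f, rs) (11 * length x + 1)
    (f(V := [], T := [], 0 := replicate (length x) True @ f 0, B := rev x @ f B), rs)"
  using assms(2-)
proof (induction x arbitrary: f)
  case Nil
  then show ?case
    unfolding restore_input_def by (intro reaches_While_stopI) (auto simp: fun_eq_iff)
next
  case (Cons b x)
  let ?f = "f(V := replicate (length x) True, T := x, 0 := True # f 0, B := b # f B)"
  have 1: "reaches_state (block [Pop V, Push 0 True, move T B]) (f, rs) 9 (?f, rs)"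
    by (rule reaches_effectI) (use Cons.prems assms in \<open>auto simp: push_def fun_eq_iff\<close>)
  have 2: "reaches_state (restore_input B T V) (?f, rs) (11 * length x + 1)
    (?f(V := [], T := [], 0 := replicate (length x) True @ ?f 0, B := rev x @ ?f B), rs)"
    using Cons.prems assms by (intro Cons.IH) auto
  have "test_val (f, rs) (Nonempty V)" using Cons.prems by simp
  from reaches_While_step_state[OF this 1 2[unfolded restore_input_def]]
  show ?case
    unfolding restore_input_def
    by (rule reaches_eqI) (use assms in \<open>auto simp: fun_eq_iff replicate_app_Cons_same\<close>)
qed

subsection \<open>Running a gate list on a bit string\<close>

fun apply_gate :: "gate \<Rightarrow> bool list \<Rightarrow> bool list" where
  "apply_gate (Toffoli a b c) x = x[c := (x ! c \<noteq> (x ! a \<and> x ! b))]"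
| "apply_gate (Diagonal l qs) x = x"

lemma length_apply_gate [simp]: "length (apply_gate g x) = length x"
  by (cases g) auto

lemma length_fold_apply_gate [simp]: "length (fold apply_gate gs x) = length x"
  by (induction gs arbitrary: x) auto

text \<open>\<open>B\<close> and \<open>T\<close> form a zipper: each unary digit shifts one entry
  across, until the addressed entry is on top of \<open>B\<close>. The last \<open>Pop 0\<close>
  removes the terminator of the index.\<close>

definition seek :: "nat \<Rightarrow> nat \<Rightarrow> prog" where
  "seek B T = Seq (While (Top 0) (Seq (Pop 0) (move B T))) (Pop 0)"

definition rewind :: "nat \<Rightarrow> nat \<Rightarrow> prog" where
  "rewind B T = While (Nonempty T) (move T B)"

text \<open>With a unary index on the input stack \<open>0\<close>, \<open>at_index B T c\<close> runs \<open>c\<close> with the entry of the list on stack \<open>B\<close>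
  at that index on top; \<open>c\<close> may overwrite the entry.\<close>

definition at_index :: "nat \<Rightarrow> nat \<Rightarrow> prog \<Rightarrow> prog" where
  "at_index B T c = Seq (seek B T) (Seq c (rewind B T))"

lemma reaches_seek:
  assumes "distinct [0, B, T]" "f 0 = enc_nat (length u) @ e" "f B = u @ v"
  shows "reaches_state (seek B T) (f, rs) (8 * length u + 3)
    (f(0 := e, B := v, T := rev u @ f T), rs)"
proof -
  have "reaches_state (While (Top 0) (Seq (Pop 0) (move B T))) (f, rs) (8 * length u + 1)
    (f(0 := False # e, B := v, T := rev u @ f T), rs)"
    using assms(2-)
  proof (induction u arbitrary: f)
    case Nil
    then show ?case by (intro reaches_While_stopI) (auto simp: fun_eq_iff enc_nat_def)
  next
    case (Cons b u)
    let ?f = "f(0 := enc_nat (length u) @ e, B := u @ v, T := b # f T)"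
    have 1: "reaches_state (Seq (Pop 0) (move B T)) (f, rs) 6 (?f, rs)"
      by (rule reaches_effectI) (use Cons.prems assms in \<open>auto simp: fun_eq_iff enc_nat_def\<close>)
    have 2: "reaches_state (While (Top 0) (Seq (Pop 0) (move B T))) (?f, rs) (8 * length u + 1)
      (?f(0 := False # e, B := v, T := rev u @ ?f T), rs)"
      using assms(1) by (intro Cons.IH) auto
    have "test_val (f, rs) (Top 0)" using Cons.prems by (simp add: enc_nat_def)
    from reaches_While_step_state[OF this 1 2] show ?case
      by (rule reaches_eqI) (use assms(1) in \<open>auto simp: fun_eq_iff\<close>)
  qed
  moreover have "reaches_state (Pop 0) (f(0 := False # e, B := v, T := rev u @ f T), rs) 1
      (f(0 := e, B := v, T := rev u @ f T), rs)"
    by (rule reaches_effectI) (use assms in \<open>auto simp: fun_eq_iff\<close>)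
  ultimately show ?thesis
    unfolding seek_def by (rule reaches_eqI[OF reaches_Seq_state]) auto
qed

lemma reaches_rewind:
  assumes "distinct [B, T]" "f T = u"
  shows "reaches_state (rewind B T) (f, rs) (6 * length u + 1) (f(T := [], B := rev u @ f B), rs)"
  using assms(2)
proof (induction u arbitrary: f)
  case Nil
  then show ?case
    unfolding rewind_def by (intro reaches_While_stopI) (auto simp: fun_eq_iff)
next
  case (Cons b u)
  let ?f = "f(T := u, B := b # f B)"
  have 1: "reaches_state (move T B) (f, rs) 4 (?f, rs)"
    by (rule reaches_effectI) (use Cons.prems assms in \<open>auto simp: fun_eq_iff\<close>)
  have 2: "reaches_state (rewind B T) (?f, rs) (6 * length u + 1) (?f(T := [], B := rev u @ ?f B), rs)"
    using assms(1) by (intro Cons.IH) auto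
  have "test_val (f, rs) (Nonempty T)" using Cons.prems by simp
  from reaches_While_step_state[OF this 1 2[unfolded rewind_def]]
  show ?case
    unfolding rewind_def by (rule reaches_eqI) (use assms(1) in \<open>auto simp: fun_eq_iff\<close>)
qed

text \<open>Seeking costs 8 and rewinding 6 steps per position. The premise \<open>eff\<close>
  speaks of states \<open>g\<close> that are fixed only on \<open>B\<close> and \<open>V\<close>,
  because stacks \<open>0\<close> and \<open>T\<close> have changed by the time \<open>c\<close>
  runs.\<close>

lemma reaches_at_index:
  assumes "distinct [0, B, T, V]" "f 0 = enc_nat a @ e" "f B = x" "f T = []" "a < length x"
    and "straight_line c" "cost c \<le> k"
    and eff: "\<And>g. g V = f V \<Longrightarrow> g B = x ! a # drop (Suc a) x \<Longrightarrow>
      effect c (g, rs) = (g(B := b # drop (Suc a) x, V := z), rs)"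
  shows "reaches_state (at_index B T c) (f, rs) (14 * a + k + 6)
    (f(0 := e, B := x[a := b], V := z), rs)"
proof -
  let ?f1 = "f(0 := e, B := drop a x, T := rev (take a x))"
  let ?f2 = "?f1(B := b # drop (Suc a) x, V := z)"
  have 1: "reaches_state (seek B T) (f, rs) (8 * a + 3) (?f1, rs)"
    using reaches_seek[of B T f "take a x" e "drop a x" rs] assms by (simp add: min_def)
  have "effect c (?f1, rs) = (?f2, rs)"
    using eff[of ?f1] assms by (auto simp: Cons_nth_drop_Suc)
  then have 2: "reaches_state c (?f1, rs) k (?f2, rs)"
    using assms by (intro reaches_effectI)
  have 3: "reaches_state (rewind B T) (?f2, rs) (6 * a + 1) (?f2(T := [], B := take a x @ ?f2 B), rs)"
    using reaches_rewind[of B T ?f2 "rev (take a x)" rs] assms by (simp add: min_def)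
  have eq: "?f2(T := [], B := take a x @ ?f2 B) = f(0 := e, B := x[a := b], V := z)"
    using assms by (auto simp: fun_eq_iff upd_conv_take_nth_drop)
  show ?thesis
    using reaches_Seq_state[OF 1 reaches_Seq_state[OF 2 3[unfolded eq]]]
    by (auto simp: at_index_def elim: reaches_mono)
qed

text \<open>One pass per index, in the order of the encoding. \<open>V\<close> carries the first
  control bit, then the conjunction of both, and is emptied after the target has been
  treated.\<close>

definition toffoli_prog :: "nat \<Rightarrow> nat \<Rightarrow> nat \<Rightarrow> prog" where
  "toffoli_prog B T V = Seq (at_index B T (Cond (Top B) (Push V True) (Push V False)))
     (Seq (at_index B T (Cond (Top B) Skip (Seq (Pop V) (Push V False))))
       (at_index B T (Seq (Cond (Top V)
           (Cond (Top B) (Seq (Pop B) (Push B False)) (Seq (Pop B) (Push B True))) Skip) (Pop V))))"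

lemma reaches_toffoli_prog:
  assumes "distinct [0, B, T, V]" "f 0 = enc_nat a @ enc_nat b @ enc_nat c @ e"
    and "f B = x" "f T = []" "f V = []" "a < length x" "b < length x" "c < length x"
  shows "reaches_state (toffoli_prog B T V) (f, rs) (14 * (a + b + c) + 50)
    (f(0 := e, B := apply_gate (Toffoli a b c) x), rs)"
proof -
  \<comment> \<open>The updates of \<open>x\<close> by its own entries keep the shape that
    \<open>reaches_at_index\<close> delivers.\<close>
  let ?f1 = "f(0 := enc_nat b @ enc_nat c @ e, B := x[a := x ! a], V := [x ! a])"
  let ?f2 = "?f1(0 := enc_nat c @ e, B := x[b := x ! b], V := [x ! a \<and> x ! b])"
  let ?x = "apply_gate (Toffoli a b c) x"
  let ?f3 = "?f2(0 := e, B := ?x, V := [])"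
  \<comment> \<open>The allowance 10 covers each of the three bodies; three times 16 and two
    transitions make 50.\<close>
  have 1: "reaches_state (at_index B T (Cond (Top B) (Push V True) (Push V False))) (f, rs)
      (14 * a + 10 + 6) (?f1, rs)"
    by (rule reaches_at_index) (use assms in \<open>auto simp: push_def fun_eq_iff\<close>)
  have 2: "reaches_state (at_index B T (Cond (Top B) Skip (Seq (Pop V) (Push V False)))) (?f1, rs)
      (14 * b + 10 + 6) (?f2, rs)"
    by (rule reaches_at_index) (use assms in \<open>auto simp: push_def fun_eq_iff\<close>)
  have 3: "reaches_state (at_index B T (Seq (Cond (Top V)
           (Cond (Top B) (Seq (Pop B) (Push B False)) (Seq (Pop B) (Push B True))) Skip) (Pop V)))
      (?f2, rs) (14 * c + 10 + 6) (?f3, rs)"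
    unfolding apply_gate.simps
    by (rule reaches_at_index) (use assms in \<open>auto simp: push_def fun_eq_iff\<close>)
  have eq: "?f3 = f(0 := e, B := ?x)" using assms by (auto simp: fun_eq_iff)
  show ?thesis
    using reaches_Seq_state[OF 1 reaches_Seq_state[OF 2 3[unfolded eq]]]
    by (auto simp: toffoli_prog_def elim: reaches_mono)
qed

section \<open>Parsing self-delimiting lists\<close>

definition for_each :: "prog \<Rightarrow> prog" where
  "for_each c = Seq (While (Top 0) (Seq (Pop 0) c)) (Pop 0)"

text \<open>The abstract value \<open>z\<close> describes all stacks but the stream on stack
  \<open>0\<close>. An element's mark \<open>True\<close> pays for the constant part
  \<open>k + 4\<close> of its iteration, the final \<open>False\<close> for leaving the loop; hence
  a bound linear in the encoding.\<close>

lemma reaches_for_each: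
  fixes f :: "'z \<Rightarrow> nat \<Rightarrow> bool list"
  assumes body: "\<And>y e z. y \<in> set ys \<Longrightarrow> P z \<Longrightarrow>
      reaches_state c ((f z)(0 := enc y @ e), rs) (k * length (enc y) + k) ((f (h y z))(0 := e), rs)"
    and inv: "\<And>y z. y \<in> set ys \<Longrightarrow> P z \<Longrightarrow> P (h y z)"
    and "P z"
  shows "reaches_state (for_each c) ((f z)(0 := enc_list enc ys @ e), rs)
    ((k + 4) * length (enc_list enc ys)) ((f (fold h ys z))(0 := e), rs)"
proof -
  have "reaches_state (While (Top 0) (Seq (Pop 0) c)) ((f z)(0 := enc_list enc ys @ e), rs)
      ((k + 4) * length (concat (map (\<lambda>x. True # enc x) ys)) + 1)
      ((f (fold h ys z))(0 := False # e), rs)"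
    using assms
  proof (induction ys arbitrary: z)
    case Nil
    show ?case by (intro reaches_While_stopI) (auto simp: enc_list_def)
  next
    case (Cons y ys)
    have 1: "reaches_state (Pop 0) ((f z)(0 := enc_list enc (y # ys) @ e), rs) 1
        ((f z)(0 := enc y @ enc_list enc ys @ e), rs)"
      by (rule reaches_effectI) (auto simp: enc_list_def)
    have 2: "reaches_state c ((f z)(0 := enc y @ enc_list enc ys @ e), rs)
        (k * length (enc y) + k) ((f (h y z))(0 := enc_list enc ys @ e), rs)"
      by (rule Cons.prems(1)) (use Cons.prems(3) in auto)
    have 3: "reaches_state (While (Top 0) (Seq (Pop 0) c)) ((f (h y z))(0 := enc_list enc ys @ e), rs)
      ((k + 4) * length (concat (map (\<lambda>x. True # enc x) ys)) + 1)
      ((f (fold h ys (h y z)))(0 := False # e), rs)"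
      by (rule Cons.IH) (use Cons.prems in auto)
    have "test_val ((f z)(0 := enc_list enc (y # ys) @ e), rs) (Top 0)" by (simp add: enc_list_def)
    from reaches_While_step_state[OF this reaches_Seq_state[OF 1 2] 3] show ?case
      by (rule reaches_eqI) (auto simp: algebra_simps)
  qed
  moreover have "reaches_state (Pop 0) ((f (fold h ys z))(0 := False # e), rs) 1
      ((f (fold h ys z))(0 := e), rs)"
    by (rule reaches_effectI) auto
  ultimately show ?thesis
    unfolding for_each_def
    by (rule reaches_eqI[OF reaches_Seq_state]) (auto simp: enc_list_def algebra_simps)
qed

lemma reaches_for_each_skip:
  assumes "\<And>y e f. y \<in> set ys \<Longrightarrow>
      reaches_state c (f(0 := enc y @ e), rs) (k * length (enc y) + k) (f(0 := e), rs)"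
  shows "reaches_state (for_each c) (f(0 := enc_list enc ys @ e), rs)
    ((k + 4) * length (enc_list enc ys)) (f(0 := e), rs)"
  by (rule reaches_for_each[where f = "\<lambda>z. f" and h = "\<lambda>y z. z" and P = "\<lambda>_. True"])
    (use assms in auto)

definition skip_nat :: prog where
  "skip_nat = Seq (While (Top 0) (Pop 0)) (Pop 0)"

lemma reaches_skip_nat:
  "reaches_state skip_nat (f(0 := enc_nat a @ e), rs) (3 * length (enc_nat a) + 3) (f(0 := e), rs)"
proof -
  have "reaches_state (While (Top 0) (Pop 0)) (f(0 := enc_nat a @ e), rs) (3 * a + 1)
      (f(0 := False # e), rs)"
  proof (induction a)
    case 0
    show ?case by (intro reaches_While_stopI) (auto simp: enc_nat_def)
  next
    case (Suc a)
    have 1: "reaches_state (Pop 0) (f(0 := enc_nat (Suc a) @ e), rs) 1 (f(0 := enc_nat a @ e), rs)"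
      by (rule reaches_effectI) (auto simp: enc_nat_def)
    have "test_val (f(0 := enc_nat (Suc a) @ e), rs) (Top 0)" by (simp add: enc_nat_def)
    from reaches_While_step_state[OF this 1 Suc.IH] show ?case
      by (rule reaches_eqI) auto
  qed
  moreover have "reaches_state (Pop 0) (f(0 := False # e), rs) 1 (f(0 := e), rs)"
    by (rule reaches_effectI) auto
  ultimately show ?thesis
    unfolding skip_nat_def by (rule reaches_eqI[OF reaches_Seq_state]) (auto simp: enc_nat_def)
qed

text \<open>A diagonal gate leaves the bits alone, but its label and qubit list must be parsed away
  to expose the next gate.\<close>

definition gate_prog :: "nat \<Rightarrow> nat \<Rightarrow> nat \<Rightarrow> prog" where
  "gate_prog B T V = Cond (Top 0) (Seq (Pop 0) (toffoli_prog B T V))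
     (Seq (Pop 0) (Seq (for_each (Pop 0)) (for_each skip_nat)))"

lemma reaches_gate_prog:
  assumes "distinct [0, B, T, V]" "f T = []" "f V = []" "wf_gate lib (length x) g"
  shows "reaches_state (gate_prog B T V) (f(B := x, 0 := enc_gate g @ e), rs)
    (60 * length (enc_gate g) + 60) (f(B := apply_gate g x, 0 := e), rs)"
proof (cases g)
  case (Toffoli a b c)
  let ?e = "enc_nat a @ enc_nat b @ enc_nat c @ e"
  have 1: "reaches_state (Pop 0) (f(B := x, 0 := enc_gate g @ e), rs) 1 (f(B := x, 0 := ?e), rs)"
    by (rule reaches_effectI) (use Toffoli in auto)
  have 2: "reaches_state (toffoli_prog B T V) (f(B := x, 0 := ?e), rs) (14 * (a + b + c) + 50)
      (f(B := x, 0 := ?e, 0 := e, B := apply_gate (Toffoli a b c) x), rs)"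
    by (rule reaches_toffoli_prog) (use assms Toffoli in auto)
  have "reaches (if test_val (f(B := x, 0 := enc_gate g @ e), rs) (Top 0)
      then Seq (Pop 0) (toffoli_prog B T V)
      else Seq (Pop 0) (Seq (for_each (Pop 0)) (for_each skip_nat)))
      (f(B := x, 0 := enc_gate g @ e), rs) (1 + (14 * (a + b + c) + 50) + 1)
      (return_pmf (f(B := x, 0 := ?e, 0 := e, B := apply_gate (Toffoli a b c) x), rs))"
    using reaches_Seq_state[OF 1 2] Toffoli by simp
  from reaches_Cond[OF this] show ?thesis
    unfolding gate_prog_def
    by (rule reaches_eqI) (use assms Toffoli in \<open>auto simp: fun_eq_iff enc_nat_def\<close>)
next
  case (Diagonal l qs)
  let ?e = "enc_list (\<lambda>b. [b]) l @ enc_list enc_nat qs @ e"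
  let ?f = "f(B := x)"
  have 1: "reaches_state (Pop 0) (?f(0 := enc_gate g @ e), rs) 1 (?f(0 := ?e), rs)"
    by (rule reaches_effectI) (use Diagonal in auto)
  have 2: "reaches_state (for_each (Pop 0)) (?f(0 := ?e), rs)
      ((1 + 4) * length (enc_list (\<lambda>b. [b]) l)) (?f(0 := enc_list enc_nat qs @ e), rs)"
    by (rule reaches_for_each_skip) (rule reaches_effectI; auto)
  have 3: "reaches_state (for_each skip_nat) (?f(0 := enc_list enc_nat qs @ e), rs)
      ((3 + 4) * length (enc_list enc_nat qs)) (?f(0 := e), rs)"
    by (rule reaches_for_each_skip) (rule reaches_skip_nat)
  have "reaches (if test_val (?f(0 := enc_gate g @ e), rs) (Top 0)
      then Seq (Pop 0) (toffoli_prog B T V)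
      else Seq (Pop 0) (Seq (for_each (Pop 0)) (for_each skip_nat)))
      (?f(0 := enc_gate g @ e), rs)
      (1 + ((1 + 4) * length (enc_list (\<lambda>b. [b]) l) + (3 + 4) * length (enc_list enc_nat qs) + 1) + 1)
      (return_pmf (?f(0 := e), rs))"
    using reaches_Seq_state[OF 1 reaches_Seq_state[OF 2 3]] Diagonal by simp
  from reaches_Cond[OF this] show ?thesis
    unfolding gate_prog_def by (rule reaches_eqI) (use assms Diagonal in auto)
qed

lemma reaches_run_gates:
  assumes "distinct [0, B, T, V]" "f 0 = enc_circuit gs" "f B = x" "f T = []" "f V = []"
    and "\<forall>g\<in>set gs. wf_gate lib (length x) g"
  shows "reaches_state (for_each (gate_prog B T V)) (f, rs) (64 * length (enc_circuit gs))
    (f(B := fold apply_gate gs x, 0 := []), rs)"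
proof -
  have "reaches_state (for_each (gate_prog B T V)) (f(B := x, 0 := enc_list enc_gate gs @ []), rs)
      ((60 + 4) * length (enc_list enc_gate gs)) (f(B := fold apply_gate gs x, 0 := []), rs)"
    \<comment> \<open>The invariant keeps the number of qubits fixed, so the indices of all later
      gates stay in range.\<close>
    by (rule reaches_for_each[where f = "\<lambda>z. f(B := z)" and P = "\<lambda>z. length z = length x"],
      rule reaches_gate_prog) (use assms in auto)
  moreover have "f(B := x, 0 := enc_list enc_gate gs @ []) = f"
    using assms by (auto simp: enc_circuit_def fun_eq_iff)
  ultimately show ?thesis by (simp add: enc_circuit_def)
qed

subsection \<open>Selecting the measured bits\<close>

definition select :: "nat \<Rightarrow> nat \<Rightarrow> prog" where
  "select T W = While (Nonempty T) (Seq (Cond (Top W) (move T 0) (Pop T)) (Pop W))"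

text \<open>The largest index is on top of the reversed stacks, whence the induction from the end of
  \<open>y\<close>; pushing downward from it leaves the selected bits in increasing order.\<close>

lemma reaches_select:
  assumes "distinct [0, T, W]" "f T = rev y" "f W = rev (subset_data (length y) S)"
  shows "reaches_state (select T W) (f, rs) (9 * length y + 1)
    (f(T := [], W := [], 0 := nths y S @ f 0), rs)"
  using assms(2-)
proof (induction y arbitrary: f rule: rev_induct)
  case Nil
  then show ?case
    unfolding select_def
    by (intro reaches_While_stopI) (auto simp: fun_eq_iff subset_data_def)
next
  case (snoc b y)
  let ?n = "length y"
  let ?f = "f(T := rev y, W := rev (subset_data ?n S), 0 := (if ?n \<in> S then b # f 0 else f 0))"
  have 1: "reaches_state (Seq (Cond (Top W) (move T 0) (Pop T)) (Pop W)) (f, rs) 7 (?f, rs)"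
    by (rule reaches_effectI) (use snoc.prems assms(1) in \<open>auto simp: fun_eq_iff subset_data_def\<close>)
  have 2: "reaches_state (select T W) (?f, rs) (9 * length y + 1)
      (?f(T := [], W := [], 0 := nths y S @ ?f 0), rs)"
    using assms(1) by (intro snoc.IH) auto
  have "test_val (f, rs) (Nonempty T)" using snoc.prems by simp
  from reaches_While_step_state[OF this 1 2[unfolded select_def]] show ?case
    unfolding select_def
    by (rule reaches_eqI) (use assms(1) in \<open>auto simp: fun_eq_iff nths_append\<close>)
qed

subsection \<open>The complete program\<close>

text \<open>The notion of \<open>samples_within\<close> from an arbitrary state. Observing only
  stack 0 is essential, since the generator may leave anything, even random bits, on its other
  stacks.\<close>

definition outputs :: "prog \<Rightarrow> state \<Rightarrow> nat \<Rightarrow> bool list pmf \<Rightarrow> bool" where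
  "outputs c s t D \<longleftrightarrow> (\<forall>x\<in>set_pmf (run t (c, s)). fst x = Skip) \<and>
     map_pmf (\<lambda>x. fst (snd x) 0) (run t (c, s)) = D"

lemma samples_within_iff_outputs: "samples_within c inp rs t D \<longleftrightarrow> outputs c (init inp rs) t D"
  by (simp add: samples_within_def outputs_def)

lemma outputs_reaches:
  assumes "reaches c s t D"
  shows "outputs c s t (map_pmf (\<lambda>s. fst s 0) D)"
  using assms by (auto simp: outputs_def reaches_def map_pmf_comp)

lemma outputs_mono:
  assumes "outputs c s t D" "t \<le> t'"
  shows "outputs c s t' D"
proof -
  have "reaches c s t' (map_pmf snd (run t (c, s)))"
    using assms by (auto simp: outputs_def intro: reaches_mono run_halted)
  from outputs_reaches[OF this] show ?thesis
    using assms(1) by (simp add: outputs_def map_pmf_comp)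
qed

text \<open>Given \<open>x\<close>, the output of \<open>d\<close> is certain, whatever else
  \<open>d\<close> leaves behind; so the randomness of the final output is that of \<open>P\<close>
  pushed through \<open>h\<close>.\<close>

lemma outputs_Seq:
  assumes "reaches c s t (map_pmf f P)"
    and "\<And>x. x \<in> set_pmf P \<Longrightarrow> outputs d (f x) t' (return_pmf (h x))"
  shows "outputs (Seq c d) s (t + t' + 1) (map_pmf h P)"
proof -
  let ?E = "\<lambda>s. map_pmf snd (run t' (d, s))"
  have "reaches (Seq c d) s (t + t' + 1) (bind_pmf (map_pmf f P) ?E)"
  proof (rule reaches_Seq[OF assms(1)])
    fix s assume "s \<in> set_pmf (map_pmf f P)"
    then obtain x where "x \<in> set_pmf P" "s = f x" by auto
    then show "reaches d s t' (?E s)"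
      using assms(2)[of x] by (intro run_halted) (simp add: outputs_def)
  qed
  from outputs_reaches[OF this]
  have "outputs (Seq c d) s (t + t' + 1)
      (bind_pmf P (\<lambda>x. map_pmf (\<lambda>x. fst (snd x) 0) (run t' (d, f x))))"
    by (simp add: map_bind_pmf bind_map_pmf map_pmf_comp)
  also have "bind_pmf P (\<lambda>x. map_pmf (\<lambda>x. fst (snd x) 0) (run t' (d, f x)))
      = bind_pmf P (\<lambda>x. return_pmf (h x))"
    using assms(2) by (intro bind_pmf_cong) (auto simp: outputs_def)
  finally show ?thesis by (simp add: map_pmf_def)
qed

lemma outputs_Seq_state:
  assumes "reaches_state c s t s'" "outputs d s' t' (return_pmf z)"
  shows "outputs (Seq c d) s (t + t' + 1) (return_pmf z)"
  using outputs_Seq[where f = "\<lambda>_. s'" and P = "return_pmf ()" and h = "\<lambda>_. z"] assms by simp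

text \<open>Stacks reverse what is moved through them: \<open>restore_input\<close> turns the sampled bits round, whereas
  \<open>W\<close> keeps the membership bits of \<open>S\<close> last index first, as \<open>select\<close> builds its output from the end.\<close>

definition simulator :: "nat \<Rightarrow> prog \<Rightarrow> prog" where
  "simulator M c = (let B = M; T = M + 1; V = M + 2; W = M + 3 in
     Seq (While (Nonempty 0) (sample_bit T V W)) (Seq (restore_input B T V) (Seq c
       (Seq (for_each (gate_prog B T V)) (Seq (rewind T B) (select T W))))))"

text \<open>The budget is \<open>31 * N\<close> for sampling, \<open>11 * N\<close> for restoring
  the input, \<open>t\<close> for the generator, \<open>64 * (N + t)\<close> for the gates and
  \<open>15 * N\<close> for rewinding and selecting; the constant 20 leaves slack.\<close>

lemma outputs_simulator:
  assumes "2 \<le> M" "stacks c \<subseteq> {..<M}"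
    and c: "samples_within c [replicate N True] [] t (return_pmf (enc_circuit gs))"
    and wf: "\<forall>g\<in>set gs. wf_gate lib N g"
    and ds: "length ds = N" "\<forall>d\<in>set ds. length d = 8"
  shows "samples_within (simulator M c) [replicate N True, subset_data N S] (concat ds)
    (65 * t + 121 * N + 20)
    (map_pmf (\<lambda>x. nths (fold apply_gate gs x) S) (bernoulli_list (map sq_norm45 ds)))"
proof -
  define B T V W where BTVW: "B = M" "T = M + 1" "V = M + 2" "W = M + 3"
  define sub where "sub = subset_data N S"
  define n where "n = replicate N True"
  define f where "f = fst (init [n, sub] [])"
  let ?f1 = "\<lambda>x. f(0 := [], 1 := [], V := n @ f V, W := rev sub @ f W, T := rev x @ f T)"
  \<comment> \<open>Apart from \<open>W\<close> and \<open>B\<close>, which lie above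
    \<open>M\<close>, this is the generator's own initial state.\<close>
  let ?f2 = "\<lambda>x. (\<lambda>_. [])(0 := n, W := rev sub, B := x)"
  have dist: "distinct [0, 1, B, T, V, W]" using assms(1) by (auto simp: BTVW)
  have len: "length sub = N" by (simp add: sub_def subset_data_def)
  have f0: "f 0 = n" "f 1 = sub" "\<And>r. 2 \<le> r \<Longrightarrow> f r = []"
    by (auto simp: f_def init_def)
  have 1: "reaches (While (Nonempty 0) (sample_bit T V W)) (f, concat ds) (31 * N + 1)
      (map_pmf (\<lambda>x. (?f1 x, [])) (bernoulli_list (map sq_norm45 ds)))"
    using reaches_sample_bits[of T V W ds f sub] dist ds f0(1,2) len by (simp add: n_def)
  have halts: "\<forall>x\<in>set_pmf (run t (c, init [n] [])). fst x = Skip"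
    and enc: "\<And>x. x \<in> set_pmf (run t (c, init [n] [])) \<Longrightarrow> fst (snd x) 0 = enc_circuit gs"
  proof -
    show "\<forall>x\<in>set_pmf (run t (c, init [n] [])). fst x = Skip"
      using c by (simp add: samples_within_def n_def)
    have "set_pmf (map_pmf (\<lambda>x. fst (snd x) 0) (run t (c, init [n] []))) = {enc_circuit gs}"
      using c by (simp add: samples_within_def n_def)
    then show "fst (snd x) 0 = enc_circuit gs" if "x \<in> set_pmf (run t (c, init [n] []))" for x
      using that by auto
  qed
  have len_enc: "length (enc_circuit gs) \<le> N + t"
  proof -
    \<comment> \<open>Any one path suffices, as all of them end with the description on stack
      \<open>0\<close>.\<close>
    obtain c' s' where x: "(c', s') \<in> set_pmf (run t (c, init [n] []))"
      using set_pmf_not_empty[of "run t (c, init [n] [])"] by fastforce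
    show ?thesis
      using run_length[OF x, of 0] enc[OF x] by (simp add: init_def n_def)
  qed
  have 2: "reaches_state (restore_input B T V) (?f1 x, []) (11 * N + 1) (?f2 x, [])"
    if "length x = N" for x
  proof (rule reaches_eqI)
    show "reaches_state (restore_input B T V) (?f1 x, []) (11 * length (rev x) + 1)
      ((?f1 x)(V := [], T := [], 0 := replicate (length (rev x)) True @ ?f1 x 0,
        B := rev (rev x) @ ?f1 x B), [])"
      by (rule reaches_restore_input)
        (use dist that assms(1) in \<open>auto simp: n_def f0 BTVW\<close>)
    have "f r = []" if "r \<noteq> 0" "r \<noteq> 1" for r
      using that by (intro f0) auto
    then show "return_pmf ((?f1 x)(V := [], T := [], 0 := replicate (length (rev x)) True @ ?f1 x 0,
        B := rev (rev x) @ ?f1 x B), []) = return_pmf (?f2 x, [])"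
      using dist that by (auto simp: fun_eq_iff n_def)
  qed (use that in auto)
  have 3: "reaches c (?f2 x, []) t
      (map_pmf (\<lambda>y. frame M (?f2 x) (snd y)) (run t (c, init [n] [])))" for x
  proof -
    have "(?f2 x, []) = frame M (?f2 x) (init [n] [])"
      using assms(1) by (auto simp: frame_def init_def fun_eq_iff BTVW)
    then have "run t (c, (?f2 x, [])) = map_pmf (apsnd (frame M (?f2 x))) (run t (c, init [n] []))"
      by (simp only: run_frame[OF assms(2)])
    also have "\<dots> = map_pmf (Pair Skip) (map_pmf (\<lambda>y. frame M (?f2 x) (snd y)) (run t (c, init [n] [])))"
      unfolding map_pmf_comp using halts by (intro map_pmf_cong) auto
    finally show ?thesis by (simp only: reaches_def)
  qed
  have 4: "outputs (Seq (for_each (gate_prog B T V)) (Seq (rewind T B) (select T W)))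
      (frame M (?f2 x) (snd y)) (64 * (N + t) + 15 * N + 4)
      (return_pmf (nths (fold apply_gate gs x) S))"
    if "length x = N" "y \<in> set_pmf (run t (c, init [n] []))" for x y
  proof -
    obtain g rs where s: "frame M (?f2 x) (snd y) = (g, rs)" by fastforce
    have g: "g = fst (frame M (?f2 x) (snd y))" by (simp add: s)
    have g0: "g 0 = enc_circuit gs" "g B = x" "g T = []" "g V = []" "g W = rev sub"
      unfolding g frame_def using assms(1) enc[OF that(2)] by (auto simp: BTVW)
    let ?y = "fold apply_gate gs x"
    let ?g1 = "g(B := ?y, 0 := [])"
    let ?g2 = "?g1(B := [], T := rev ?y @ ?g1 T)"
    have a: "reaches_state (for_each (gate_prog B T V)) (g, rs) (64 * length (enc_circuit gs)) (?g1, rs)"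
      by (rule reaches_run_gates) (use dist g0 wf that in auto)
    have b: "reaches_state (rewind T B) (?g1, rs) (6 * length ?y + 1) (?g2, rs)"
      by (rule reaches_rewind) (use dist g0 in auto)
    have c: "reaches_state (select T W) (?g2, rs) (9 * length ?y + 1)
        (?g2(T := [], W := [], 0 := nths ?y S @ ?g2 0), rs)"
      by (rule reaches_select) (use dist g0 that in \<open>auto simp: sub_def\<close>)
    have "outputs (Seq (for_each (gate_prog B T V)) (Seq (rewind T B) (select T W))) (g, rs)
        (64 * length (enc_circuit gs) + (6 * length ?y + 1 + (9 * length ?y + 1) + 1) + 1)
        (return_pmf (nths ?y S))"
      using outputs_reaches[OF reaches_Seq_state[OF a reaches_Seq_state[OF b c]]] dist by simp
    then show ?thesis
      unfolding s by (rule outputs_mono) (use len_enc that in simp)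
  qed
  have 5: "outputs (Seq c (Seq (for_each (gate_prog B T V)) (Seq (rewind T B) (select T W))))
      (?f2 x, []) (t + (64 * (N + t) + 15 * N + 4) + 1) (return_pmf (nths (fold apply_gate gs x) S))"
    if "length x = N" for x
    \<comment> \<open>The mixture here is over the runs of the generator; \<open>h\<close> is
      constant because for fixed \<open>x\<close> they all yield the same description.\<close>
    using outputs_Seq[OF 3, where h = "\<lambda>_. nths (fold apply_gate gs x) S", OF 4[OF that]] by simp
  have 6: "outputs (Seq (restore_input B T V)
      (Seq c (Seq (for_each (gate_prog B T V)) (Seq (rewind T B) (select T W)))))
      (?f1 x, []) (11 * N + 1 + (t + (64 * (N + t) + 15 * N + 4) + 1) + 1)
      (return_pmf (nths (fold apply_gate gs x) S))"
    if "length x = N" for x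
    by (rule outputs_Seq_state[OF 2[OF that] 5[OF that]])
  have sim: "simulator M c = Seq (While (Nonempty 0) (sample_bit T V W)) (Seq (restore_input B T V)
      (Seq c (Seq (for_each (gate_prog B T V)) (Seq (rewind T B) (select T W)))))"
    by (simp add: simulator_def BTVW Let_def)
  have "outputs (simulator M c) (f, concat ds)
      (31 * N + 1 + (11 * N + 1 + (t + (64 * (N + t) + 15 * N + 4) + 1) + 1) + 1)
      (map_pmf (\<lambda>x. nths (fold apply_gate gs x) S) (bernoulli_list (map sq_norm45 ds)))"
    unfolding sim
    by (intro outputs_Seq[OF 1] 6) (use ds in \<open>auto dest: length_bernoulli_list\<close>)
  then have "outputs (simulator M c) (f, concat ds) (65 * t + 121 * N + 20)
      (map_pmf (\<lambda>x. nths (fold apply_gate gs x) S) (bernoulli_list (map sq_norm45 ds)))"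
    by (rule outputs_mono) simp
  moreover have "(f, concat ds) = init [n, sub] (concat ds)"
    by (simp add: f_def init_def)
  ultimately show ?thesis
    by (simp add: samples_within_iff_outputs n_def sub_def)
qed

section \<open>Output probabilities\<close>

lemma finite_bits: "finite (bits n)"
  using finite_lists_length_eq[of "UNIV :: bool set" n] by (simp add: bits_def)

section \<open>Gates as basis permutations up to phase\<close>

lemma apply_gate_involution:
  assumes "wf_gate lib N g" "y \<in> bits N"
  shows "apply_gate g (apply_gate g y) = y"
  \<comment> \<open>The target differs from both controls, so a second Toffoli sees the same
    controls and undoes the flip.\<close>
  using assms by (cases g) (auto simp: bits_def list_eq_iff_nth_eq nth_list_update)

lemma bij_betw_fold_apply_gate:
  assumes "\<forall>g\<in>set gs. wf_gate lib N g"
  shows "bij_betw (fold apply_gate gs) (bits N) (bits N)"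
  using assms
proof (induction gs)
  case Nil
  show ?case by (simp add: bij_betw_def)
next
  case (Cons g gs)
  have "bij_betw (apply_gate g) (bits N) (bits N)"
    by (rule bij_betw_byWitness[where f' = "apply_gate g"])
      (use Cons.prems apply_gate_involution[of lib N g] in \<open>auto simp: bits_def\<close>)
  from bij_betw_trans[OF this Cons.IH] show ?case
    using Cons.prems by (simp add: comp_def)
qed

text \<open>Toffoli is a permutation matrix, and a unitary diagonal matrix has diagonal entries of
  modulus 1. Rows are described because multiplying by the gate from the left sums along a
  row.\<close>

lemma gate_op_apply_gate:
  assumes "wf_gate lib N g" "y \<in> bits N"
  shows "\<exists>u. cmod u = 1 \<and> (\<forall>z\<in>bits N. gate_op lib N g (apply_gate g y) z = (if z = y then u else 0))"
proof (cases g)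
  case (Toffoli a b c)
  have toffoli: "toffoli [p, q, r] [u, v, w] = (if [p, q, r] = [u, v, w \<noteq> (u \<and> v)] then 1 else 0)"
    for p q r u v w by (simp add: toffoli_def)
  have if_if: "(if P then if Q then 1 else 0 else 0) = (if P \<and> Q then 1 else (0 :: complex))"
    for P Q by simp
  have "gate_op lib N g (apply_gate g y) z = (if z = y then 1 else 0)" if "z \<in> bits N" for z
  proof -
    have len: "length z = N" "length y = N" and abc: "a < N" "b < N" "c < N" "distinct [a, b, c]"
      using assms that Toffoli by (auto simp: bits_def)
    let ?y = "y[c := (y ! c \<noteq> (y ! a \<and> y ! b))]"
    \<comment> \<open>Once the controls agree, both target bits are shifted by the same conjunction,
      which cancels.\<close>
    have "(\<forall>i<N. i \<notin> {a, b, c} \<longrightarrow> ?y ! i = z ! i) \<and>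
        [?y ! a, ?y ! b, ?y ! c] = [z ! a, z ! b, z ! c \<noteq> (z ! a \<and> z ! b)]
      \<longleftrightarrow> (\<forall>i<N. z ! i = y ! i)"
      using len abc by (auto simp: nth_list_update)
    also have "\<dots> \<longleftrightarrow> z = y"
      using len by (simp add: list_eq_iff_nth_eq)
    finally have eq: "(\<forall>i<N. i \<notin> {a, b, c} \<longrightarrow> ?y ! i = z ! i) \<and>
        [?y ! a, ?y ! b, ?y ! c] = [z ! a, z ! b, z ! c \<noteq> (z ! a \<and> z ! b)] \<longleftrightarrow> z = y" .
    have "gate_op lib N g (apply_gate g y) z =
        (if (\<forall>i<N. i \<notin> {a, b, c} \<longrightarrow> ?y ! i = z ! i) \<and>
          [?y ! a, ?y ! b, ?y ! c] = [z ! a, z ! b, z ! c \<noteq> (z ! a \<and> z ! b)] then 1 else 0)"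
      unfolding Toffoli gate_op.simps apply_gate.simps embed_op_def
      by (simp only: list.map list.set toffoli if_if)
    then show ?thesis by (simp only: eq)
  qed
  then show ?thesis by (intro exI[of _ 1]) auto
next
  case (Diagonal l qs)
  let ?y = "map ((!) y) qs"
  have qs: "set qs \<subseteq> {..<N}" and un: "unitary (length qs) (lib l)" and di: "diagonal (length qs) (lib l)"
    using assms Diagonal by auto
  have y: "?y \<in> bits (length qs)" by (simp add: bits_def)
  \<comment> \<open>Normalisation of one column, in which diagonality leaves only the diagonal
    entry.\<close>
  have "(\<Sum>z\<in>bits (length qs). cnj (lib l z ?y) * lib l z ?y) = 1"
    using un y by (auto simp: unitary_def)
  also have "(\<Sum>z\<in>bits (length qs). cnj (lib l z ?y) * lib l z ?y)
      = (\<Sum>z\<in>{?y}. cnj (lib l z ?y) * lib l z ?y)"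
    using y di by (intro sum.mono_neutral_right finite_bits) (auto simp: diagonal_def)
  finally have "cnj (lib l ?y ?y) * lib l ?y ?y = 1" by simp
  then have "cmod (cnj (lib l ?y ?y) * lib l ?y ?y) = 1" by simp
  then have u: "cmod (lib l ?y ?y) = 1"
    by (simp add: norm_mult power2_eq_square[symmetric] power2_eq_1_iff)
      (smt (verit) norm_ge_zero)
  have "gate_op lib N g (apply_gate g y) z = (if z = y then lib l ?y ?y else 0)" if "z \<in> bits N" for z
  proof (cases "\<forall>i<N. i \<notin> set qs \<longrightarrow> y ! i = z ! i")
    case True
    have "?y = map ((!) z) qs \<longleftrightarrow> z = y"
    proof
      assume "?y = map ((!) z) qs"
      then have "\<forall>i\<in>set qs. y ! i = z ! i" by simp
      with True show "z = y" using that assms(2) by (auto simp: bits_def list_eq_iff_nth_eq)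
    qed simp
    moreover have "map ((!) z) qs \<in> bits (length qs)" by (simp add: bits_def)
    ultimately show ?thesis
      using Diagonal True di y by (auto simp: embed_op_def diagonal_def)
  next
    case False
    then show ?thesis using Diagonal by (auto simp: embed_op_def)
  qed
  with u show ?thesis by blast
qed

lemma cmod_gate_op_mult:
  assumes "wf_gate lib N g" "y \<in> bits N"
  shows "cmod (qop_mult N (gate_op lib N g) A (apply_gate g y) w) = cmod (A y w)"
proof -
  obtain u where u: "cmod u = 1"
    "\<And>z. z \<in> bits N \<Longrightarrow> gate_op lib N g (apply_gate g y) z = (if z = y then u else 0)"
    using gate_op_apply_gate[OF assms] by blast
  have "qop_mult N (gate_op lib N g) A (apply_gate g y) w
      = (\<Sum>z\<in>bits N. if z = y then u * A z w else 0)"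
    unfolding qop_mult_def by (intro sum.cong) (auto simp: u(2))
  also have "\<dots> = u * A y w"
    using assms(2) finite_bits by simp
  finally show ?thesis by (simp add: norm_mult u(1))
qed

text \<open>A phase does not change the modulus of an amplitude. \<open>A\<close> is arbitrary so
  that the induction can absorb the gates already applied into it.\<close>

lemma cmod_fold_gates:
  assumes "\<forall>g\<in>set gs. wf_gate lib N g" "y \<in> bits N"
  shows "cmod (fold (\<lambda>g A. qop_mult N (gate_op lib N g) A) gs A (fold apply_gate gs y) w)
    = cmod (A y w)"
  using assms
proof (induction gs arbitrary: A y)
  case (Cons g gs)
  have "apply_gate g y \<in> bits N" using Cons.prems by (simp add: bits_def)
  then show ?case using Cons by (simp add: cmod_gate_op_mult)
qed simp

text \<open>Substitute \<open>y = fold apply_gate gs x\<close>, a bijection of the basis that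
  preserves the squared moduli.\<close>

lemma outcome_prob_circuit_op:
  assumes "\<forall>g\<in>set gs. wf_gate lib N g"
  shows "outcome_prob N (circuit_op lib N U gs) S \<alpha> =
    (\<Sum>x\<in>{x \<in> bits N. nths (fold apply_gate gs x) S = \<alpha>}.
      (cmod (local_op N U x (replicate N False)))\<^sup>2)"
proof -
  let ?F = "fold apply_gate gs"
  have bij: "bij_betw ?F {x \<in> bits N. nths (?F x) S = \<alpha>} {y \<in> bits N. nths y S = \<alpha>}"
    using bij_betw_fold_apply_gate[OF assms] by (auto simp: bij_betw_def inj_on_def)
  show ?thesis
    unfolding outcome_prob_def sum.reindex_bij_betw[OF bij, symmetric] circuit_op_def
    by (intro sum.cong) (auto simp: cmod_fold_gates[OF assms])
qed

section \<open>Measurement distribution of the product state\<close>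

lemma unitary_1_column:
  assumes "unitary 1 A"
  shows "(cmod (A [True] [False]))\<^sup>2 + (cmod (A [False] [False]))\<^sup>2 = 1"
proof -
  have bits: "bits 1 = {[True], [False]}"
    by (auto simp: bits_def length_Suc_conv)
  have "[False] \<in> bits 1" by (simp add: bits_def)
  then have "(\<Sum>z\<in>bits 1. cnj (A z [False]) * A z [False]) = 1"
    using assms unfolding unitary_def by metis
  then have "complex_of_real ((cmod (A [True] [False]))\<^sup>2 + (cmod (A [False] [False]))\<^sup>2) = 1"
    unfolding bits by (simp add: complex_norm_square mult.commute del: of_real_power)
  then show ?thesis by (simp only: of_real_eq_1_iff)
qed

text \<open>Squared moduli are multiplicative, and normalisation of the first column of each
  \<open>U i\<close> turns the factor for outcome 0 into the complementary coin probability.\<close>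

lemma local_op_prob:
  assumes "\<forall>i<N. unitary 1 (U i)" "x \<in> bits N"
  shows "(cmod (local_op N U x (replicate N False)))\<^sup>2 =
    pmf (bernoulli_list (map (\<lambda>i. (cmod (U i [True] [False]))\<^sup>2) [0..<N])) x"
proof -
  let ?ps = "map (\<lambda>i. (cmod (U i [True] [False]))\<^sup>2) [0..<N]"
  have col: "(cmod (U i [False] [False]))\<^sup>2 = 1 - (cmod (U i [True] [False]))\<^sup>2" if "i < N" for i
    using unitary_1_column[of "U i"] assms(1) that by simp
  have "(cmod (U i [True] [False]))\<^sup>2 \<le> 1" if "i < N" for i
    using col[OF that] zero_le_power2[of "cmod (U i [False] [False])"] by linarith
  then have "pmf (bernoulli_list ?ps) x = (\<Prod>i<N. if x ! i then ?ps ! i else 1 - ?ps ! i)"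
    using assms(2) pmf_bernoulli_list[of ?ps x] by (auto simp: bits_def)
  also have "\<dots> = (\<Prod>i<N. (cmod (U i [x ! i] [replicate N False ! i]))\<^sup>2)"
    by (intro prod.cong) (auto simp: col)
  also have "\<dots> = (cmod (local_op N U x (replicate N False)))\<^sup>2"
    by (simp add: local_op_def prod_norm[symmetric] prod_power_distrib)
  finally show ?thesis ..
qed

lemma pmf_circuit_outcome:
  assumes "\<forall>g\<in>set gs. wf_gate lib N g" "\<forall>i<N. unitary 1 (U i)"
  shows "pmf (map_pmf (\<lambda>x. nths (fold apply_gate gs x) S)
      (bernoulli_list (map (\<lambda>i. (cmod (U i [True] [False]))\<^sup>2) [0..<N]))) \<alpha>
    = outcome_prob N (circuit_op lib N U gs) S \<alpha>"
proof -
  let ?P = "bernoulli_list (map (\<lambda>i. (cmod (U i [True] [False]))\<^sup>2) [0..<N])"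
  let ?X = "{x \<in> bits N. nths (fold apply_gate gs x) S = \<alpha>}"
  have "pmf (map_pmf (\<lambda>x. nths (fold apply_gate gs x) S) ?P) \<alpha>
      = measure (measure_pmf ?P) ((\<lambda>x. nths (fold apply_gate gs x) S) -` {\<alpha>})"
    by (rule pmf_map)
  \<comment> \<open>Strings of any other length have probability zero, so the event may be cut down
    to a finite set.\<close>
  also have "\<dots> = measure (measure_pmf ?P) ?X"
    by (rule measure_prob_cong_0)
      (auto simp: bits_def pmf_eq_0_set_pmf dest: length_bernoulli_list)
  also have "\<dots> = (\<Sum>x\<in>?X. pmf ?P x)"
    using finite_bits by (intro measure_measure_pmf_finite) auto
  also have "\<dots> = outcome_prob N (circuit_op lib N U gs) S \<alpha>"
    unfolding outcome_prob_circuit_op[OF assms(1)]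
    by (intro sum.cong) (auto simp: local_op_prob[OF assms(2)])
  finally show ?thesis .
qed

theorem mainTheorem4:
  fixes C :: "nat \<Rightarrow> gate list" and lib :: "bool list \<Rightarrow> qop"
  assumes "uniform_family C"
    and "\<And>N. \<forall>g\<in>set (C N). wf_gate lib N g"
  shows "\<exists>(sim :: prog) (p :: nat poly). \<forall>N (U :: nat \<Rightarrow> qop) (S :: nat set).
           (\<forall>i<N. unitary 1 (U i)) \<longrightarrow> S \<subseteq> {..<N} \<longrightarrow>
           (\<exists>D :: bool list pmf.
              samples_within sim [replicate N True, subset_data N S] (local_data N U) (poly p N) D \<and>
              (\<forall>\<alpha>. pmf D \<alpha> = outcome_prob N (circuit_op lib N U (C N)) S \<alpha>))"
proof -
  obtain c and p :: "nat poly" where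
    c: "\<And>N. samples_within c [replicate N True] [] (poly p N) (return_pmf (enc_circuit (C N)))"
    using assms(1) unfolding uniform_family_def by blast
  obtain M where M: "2 \<le> M" "stacks c \<subseteq> {..<M}"
  proof
    \<comment> \<open>Here \<open>insert 0\<close> makes \<open>Max\<close> meaningful even if the
      generator mentions no stack; being at least 2 keeps the simulator's own stacks apart from both
      inputs.\<close>
    show "2 \<le> Suc (Suc (Max (insert 0 (stacks c))))" by simp
    show "stacks c \<subseteq> {..<Suc (Suc (Max (insert 0 (stacks c))))}"
      using finite_stacks[of c] by (auto simp: less_Suc_eq_le le_SucI)
  qed
  let ?p = "smult 65 p + [:20, 121:]"
  have "\<exists>D. samples_within (simulator M c) [replicate N True, subset_data N S] (local_data N U)
        (poly ?p N) D \<and>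
      (\<forall>\<alpha>. pmf D \<alpha> = outcome_prob N (circuit_op lib N U (C N)) S \<alpha>)"
    if U: "\<forall>i<N. unitary 1 (U i)" for N S and U :: "nat \<Rightarrow> qop"
  proof -
    \<comment> \<open>Cuts the real tape into one block of eight numbers per qubit.\<close>
    define ds where "ds = map (\<lambda>i. concat (map (\<lambda>(a, b). [Re (U i [a] [b]), Im (U i [a] [b])])
      [(False, False), (False, True), (True, False), (True, True)])) [0..<N]"
    have ds: "length ds = N" "\<forall>d\<in>set ds. length d = 8" "concat ds = local_data N U"
      by (auto simp: ds_def local_data_def)
    have "map sq_norm45 ds = map (\<lambda>i. (cmod (U i [True] [False]))\<^sup>2) [0..<N]"
      unfolding cmod_power2 by (simp add: ds_def power2_eq_square)
    moreover have "poly ?p N = 65 * poly p N + 121 * N + 20"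
      by simp
    ultimately show ?thesis
      using outputs_simulator[OF M c assms(2) ds(1,2), of S] pmf_circuit_outcome[OF assms(2) U]
      unfolding ds(3) by metis
  qed
  then show ?thesis by blast
qed

end
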